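(* Let $\mu>-1$, $0<\gamma<1$, and let $\sigma$ be a finite positive measure on a compact interval $Q=[q_-,q_+]\subset(-1,\infty)$. Define $W(x)=\int_Q x^q\,d\sigma(q)$ for $x>0$. Then for every $\theta\in(\gamma,1)$ and all $x>0$, $$\int_0^x e^{-\gamma t}W(t)t^{-\mu}I_\mu(t)\,dt\le M_Q(\theta)\,e^{-\gamma x}W(x)x^{-\mu}I_{\mu+1}(x),$$ where $$M_Q(\theta)=\sup_{q\in Q}M_{\mu,q,\gamma}(\theta)<\infty.$$ If $Q\subset[0,\infty)$, then $M_Q(\theta)=M_{\mu,q_-,\gamma}(\theta)$.
   Context: $I_\alpha(x)=\sum_{k=0}^{\infty}\frac{(x/2)^{2k+\alpha}}{k!\,\Gamma(k+\alpha+1)}$, $x>0$, is the modified Bessel function of the first kind. For $\mu>-1$, $q>-1$, $0<\gamma<\theta<1$: $K_{\mu,q}=\max\{1,\frac{2(\mu+1)}{q+1}\}$; $X_{\mu,q}(\theta)=\frac{2(\mu+2)\theta}{1-\theta}$ if $q\ge0$, and if $-1<q<0$, $$X_{\mu,q}(\theta)=\max\left\{\frac{2(\mu+2)\theta}{1-\theta},\ \frac{(2\mu+2)\theta-q+\sqrt{\{(2\mu+2)\theta-q\}^2-4(1-\theta)q(2\mu+2)}}{2(1-\theta)}\right\};$$ $\beta_{\mu,q}(\theta)=\frac{X_{\mu,q}(\theta)}{X_{\mu,q}(\theta)+2\mu+2}$; and $M_{\mu,q,\gamma}(\theta)=\max\left\{K_{\mu,q}\exp(\gamma X_{\mu,q}(\theta)),\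 \frac{1}{\beta_{\mu,q}(\theta)(\theta-\gamma)}\right\}$. *)

theory Defs
  imports "HOL-Analysis.Analysis"
begin

definition bessel_I :: "real \<Rightarrow> real \<Rightarrow> real" where
  "bessel_I \<alpha> x =
     (\<Sum>k. (x / 2) powr (2 * real k + \<alpha>) / (fact k * Gamma (real k + \<alpha> + 1)))"

definition K_const :: "real \<Rightarrow> real \<Rightarrow> real" where
  "K_const \<mu> q = max 1 (2 * (\<mu> + 1) / (q + 1))"

definition X_const :: "real \<Rightarrow> real \<Rightarrow> real \<Rightarrow> real" where
  "X_const \<mu> q \<theta> =
     (if q \<ge> 0 then 2 * (\<mu> + 2) * \<theta> / (1 - \<theta>)
      else max (2 * (\<mu> + 2) * \<theta> / (1 - \<theta>))
               (((2 * \<mu> + 2) * \<theta> - q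
                  + sqrt (((2 * \<mu> + 2) * \<theta> - q)\<^sup>2 - 4 * (1 - \<theta>) * q * (2 * \<mu> + 2)))
                / (2 * (1 - \<theta>))))"

definition beta_const :: "real \<Rightarrow> real \<Rightarrow> real \<Rightarrow> real" where
  "beta_const \<mu> q \<theta> = X_const \<mu> q \<theta> / (X_const \<mu> q \<theta> + 2 * \<mu> + 2)"

definition M_const :: "real \<Rightarrow> real \<Rightarrow> real \<Rightarrow> real \<Rightarrow> real" where
  "M_const \<mu> q \<gamma> \<theta> =
     max (K_const \<mu> q * exp (\<gamma> * X_const \<mu> q \<theta>))
         (1 / (beta_const \<mu> q \<theta> * (\<theta> - \<gamma>)))"

text \<open>The supremum is taken in the reals, so it is only meaningful when the set of values
  is bounded above.\<close>

definition M_sup :: "real \<Rightarrow> real set \<Rightarrow> real \<Rightarrow> real \<Rightarrow> real" where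
  "M_sup \<mu> Q \<gamma> \<theta> = (SUP q\<in>Q. M_const \<mu> q \<gamma> \<theta>)"

definition W_mix :: "real measure \<Rightarrow> real \<Rightarrow> real" where
  "W_mix \<sigma> x = (LINT q|\<sigma>. x powr q)"

end

theory Submission
  imports Defs
begin

text \<open>
  Put \<open>f t = t powr (-\<mu>) * I\<^sub>\<mu> t\<close>, \<open>g t = t powr (-\<mu>) * I\<^sub>\<mu>\<^sub>+\<^sub>1 t\<close> and
  \<open>h t = t powr (-\<mu>) * I\<^sub>\<mu>\<^sub>+\<^sub>2 t\<close>. Then \<open>f = (2\<mu> + 2) * g / t + h\<close> and
  \<open>(t powr q * g)' = t powr q * ((q + 1) * g / t + h)\<close>. For a single weight \<open>t powr q\<close> the
  integral from 0 to \<open>x\<close> of \<open>p t = exp (-\<gamma> t) * t powr q * f t\<close> is bounded by comparing \<open>p\<close> with the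
  derivative of a multiple of the right-hand side, in a different way on either side of
  \<open>X = X_const \<mu> q \<theta>\<close>:

  \<^item> On \<open>(0, X]\<close> the factor \<open>exp (-\<gamma> t) \<le> 1\<close> is dropped. The constant \<open>K = K_const \<mu> q\<close> is exactly what makes
    \<open>(2\<mu> + 2) * g / t + h \<le> K * ((q + 1) * g / t + h)\<close>, so the integral is at most
    \<open>K * x powr q * g x\<close>; restoring the exponential costs at most \<open>exp (\<gamma> X)\<close>.
  \<^item> Beyond \<open>X\<close> the ratio bound \<open>t * f \<le> (t + 2\<mu> + 2) * g\<close> gives \<open>g \<ge> \<beta> f\<close>, with
    \<open>\<beta> = beta_const \<mu> q \<theta>\<close>, and the same bound
    for the next order gives \<open>h \<ge> \<theta> g\<close>. Hence the derivative of
    \<open>exp (-\<gamma> t) * t powr q * g t\<close> is at least \<open>(\<theta> - \<gamma>) * \<beta> * p t\<close>.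

  The ratio bound is the three-term recurrence combined with \<open>I\<^sub>\<nu>\<^sub>+\<^sub>1 \<le> I\<^sub>\<nu>\<close> for \<open>\<nu> > 0\<close>
  (lemmas \<open>bessel_series_ratio_lower\<close> and \<open>bessel_series_order_antimono\<close>). Tonelli's theorem
  carries the estimate \<open>power_weight_bound\<close> over to a mixture of weights. The supremum over \<open>q\<close> is finite because
  \<open>K\<close> and \<open>X\<close> are nonincreasing in \<open>q\<close> while \<open>X\<close> never falls below the positive
  number \<open>2 * (\<mu> + 2) * \<theta> / (1 - \<theta>)\<close>; for \<open>q \<ge> 0\<close> only \<open>K\<close> varies, so the supremum sits at the
  left end.
\<close>

section \<open>The entire part of the modified Bessel function\<close>

text \<open>
  With \<open>z = (x / 2)\<^sup>2\<close> this is \<open>(x / 2) powr (-\<nu>) * I\<^sub>\<nu> x\<close>. Working with it removes the real power, so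
  that all calculus near 0 takes place with an entire function, and changing the order
  of the Bessel function becomes differentiation.
\<close>

definition bessel_series :: "real \<Rightarrow> real \<Rightarrow> real" where
  "bessel_series \<nu> z = (\<Sum>k. rGamma (real k + \<nu> + 1) / fact k * z ^ k)"

text \<open>
  The ratio of consecutive terms is \<open>z / ((n + 1) * (n + \<nu> + 1))\<close>, which is at most \<open>1/2\<close> in absolute value
  once \<open>n \<ge> 1\<close> and \<open>n + 1 \<ge> 2 * \<bar>z\<bar>\<close>.
\<close>

lemma bessel_series_summable:
  assumes "\<nu> > -1"
  shows "summable (\<lambda>k. rGamma (real k + \<nu> + 1) / fact k * z ^ k)"
proof (rule summable_ratio_test)
  show "(1/2::real) < 1" by simp
  fix n assume n: "n \<ge> nat \<lceil>2 * \<bar>z\<bar>\<rceil> + 1"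
  have n1: "2 * \<bar>z\<bar> \<le> real n + 1" and n2: "real n \<ge> 1"
    using n by linarith+
  let ?f = "\<lambda>k. rGamma (real k + \<nu> + 1) / fact k * z ^ k"
  have rec: "(real n + \<nu> + 1) * rGamma (real (Suc n) + \<nu> + 1) = rGamma (real n + \<nu> + 1)"
    using rGamma_plus1[of "real n + \<nu> + 1"] by (simp add: add_ac)
  have pos: "real n + \<nu> + 1 \<ge> 1" using n2 assms by linarith
  have "?f n * z = (real n + \<nu> + 1) * (real n + 1) * ?f (Suc n)"
    unfolding rec[symmetric] fact_Suc of_nat_mult by (simp del: of_nat_Suc add: divide_simps)
  hence "\<bar>?f n\<bar> * \<bar>z\<bar> = (real n + \<nu> + 1) * (real n + 1) * \<bar>?f (Suc n)\<bar>"
    using pos by (metis abs_mult abs_of_nonneg add_nonneg_nonneg mult_nonneg_nonneg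
        of_nat_0_le_iff order_trans zero_le_one)
  also have "\<dots> \<ge> 1 * (real n + 1) * \<bar>?f (Suc n)\<bar>"
    using pos by (intro mult_right_mono) auto
  finally have a: "(real n + 1) * \<bar>?f (Suc n)\<bar> \<le> \<bar>?f n\<bar> * \<bar>z\<bar>" by simp
  also have "\<dots> \<le> \<bar>?f n\<bar> * ((real n + 1) / 2)"
    using n1 by (intro mult_left_mono) auto
  finally have "(real n + 1) * \<bar>?f (Suc n)\<bar> \<le> (real n + 1) * (1/2 * \<bar>?f n\<bar>)"
    by (simp add: field_simps)
  hence "\<bar>?f (Suc n)\<bar> \<le> 1/2 * \<bar>?f n\<bar>"
    by (rule mult_left_le_imp_le) simp
  thus "norm (?f (Suc n)) \<le> 1/2 * norm (?f n)" by simp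
qed

lemma bessel_series_has_derivative:
  assumes "\<nu> > -1"
  shows "(bessel_series \<nu> has_real_derivative bessel_series (\<nu> + 1) z) (at z)"
proof -
  let ?c = "\<lambda>k. rGamma (real k + \<nu> + 1) / fact k :: real"
  have "diffs ?c = (\<lambda>k. rGamma (real k + (\<nu> + 1) + 1) / fact k)"
    by (simp add: diffs_def fun_eq_iff add_ac del: of_nat_Suc) (simp add: add_ac)
  with termdiffs_strong_converges_everywhere[of ?c z, OF bessel_series_summable[OF assms]]
  show ?thesis by (simp add: bessel_series_def[abs_def])
qed

lemma bessel_series_quadratic_derivative [derivative_intros]:
  assumes "\<nu> > -1" and "(f has_real_derivative f') (at x)"
  shows "((\<lambda>x. bessel_series \<nu> (f x)) has_real_derivative bessel_series (\<nu> + 1) (f x) * f') (at x)"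
  using DERIV_chain2[OF bessel_series_has_derivative assms(2)] assms(1) by simp

lemma continuous_on_bessel_series [continuous_intros]:
  assumes "\<nu> > -1" and "continuous_on A f"
  shows "continuous_on A (\<lambda>x. bessel_series \<nu> (f x))"
proof -
  have "continuous_on UNIV (bessel_series \<nu>)"
    using bessel_series_has_derivative[OF assms(1)]
    by (intro continuous_at_imp_continuous_on) (auto intro: DERIV_isCont)
  thus ?thesis using assms(2) continuous_on_compose2 by blast
qed

lemma borel_measurable_bessel_series:
  assumes "\<nu> > -1"
  shows "bessel_series \<nu> \<in> borel_measurable borel"
  using continuous_on_bessel_series[OF assms continuous_on_id] by (rule borel_measurable_continuous_onI)

lemma bessel_series_nonneg:
  assumes "\<nu> > -1" and "z \<ge> 0"
  shows "bessel_series \<nu> z \<ge> 0"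
  unfolding bessel_series_def
proof (rule suminf_nonneg[OF bessel_series_summable[OF assms(1)]])
  fix k :: nat
  have "Gamma (real k + \<nu> + 1) > 0" using assms(1) by (intro Gamma_real_pos) linarith
  thus "0 \<le> rGamma (real k + \<nu> + 1) / fact k * z ^ k"
    using assms(2) by (simp add: rGamma_inverse_Gamma)
qed

text \<open>
  This is \<open>I\<^sub>\<nu> x - I\<^sub>\<nu>\<^sub>+\<^sub>2 x = (2 * (\<nu> + 1) / x) * I\<^sub>\<nu>\<^sub>+\<^sub>1 x\<close>. It follows by comparing coefficients, since
  \<open>1 / \<Gamma>(k + \<nu> + 1) = (\<nu> + 1 + k) / \<Gamma>(k + \<nu> + 2)\<close>, and the part with \<open>k\<close> cancels against \<open>k!\<close> and shifts
  the index by one.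
\<close>

lemma bessel_series_recurrence:
  assumes "\<nu> > -1"
  shows "bessel_series \<nu> z = (\<nu> + 1) * bessel_series (\<nu> + 1) z + z * bessel_series (\<nu> + 2) z"
proof -
  let ?c = "\<lambda>\<nu> k. rGamma (real k + \<nu> + 1) / fact k * z ^ k"
  have sums: "?c a sums bessel_series a z" if "a > -1" for a
    unfolding bessel_series_def by (rule summable_sums[OF bessel_series_summable[OF that]])
  have "(\<lambda>k. z * ?c (\<nu> + 2) k) sums (z * bessel_series (\<nu> + 2) z)"
    using assms by (intro sums_mult sums) auto
  moreover have "z * ?c (\<nu> + 2) k = real (Suc k) * ?c (\<nu> + 1) (Suc k)" for k
    by (simp add: add_ac)
  ultimately have "(\<lambda>k. real (Suc k) * ?c (\<nu> + 1) (Suc k)) sums (z * bessel_series (\<nu> + 2) z)"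
    by (simp only:)
  hence "(\<lambda>k. real k * ?c (\<nu> + 1) k) sums (z * bessel_series (\<nu> + 2) z + real 0 * ?c (\<nu> + 1) 0)"
    by (subst (asm) sums_Suc_iff) simp
  moreover have "(\<lambda>k. (\<nu> + 1) * ?c (\<nu> + 1) k) sums ((\<nu> + 1) * bessel_series (\<nu> + 1) z)"
    using assms by (intro sums_mult sums) auto
  ultimately have "(\<lambda>k. (\<nu> + 1) * ?c (\<nu> + 1) k + real k * ?c (\<nu> + 1) k) sums
      ((\<nu> + 1) * bessel_series (\<nu> + 1) z + z * bessel_series (\<nu> + 2) z)"
    by (intro sums_add) auto
  moreover have "(\<nu> + 1) * ?c (\<nu> + 1) k + real k * ?c (\<nu> + 1) k = ?c \<nu> k" for k
  proof -
    have "(\<nu> + 1) * ?c (\<nu> + 1) k + real k * ?c (\<nu> + 1) k =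
        (real k + \<nu> + 1) * rGamma (real k + \<nu> + 1 + 1) / fact k * z ^ k"
      by (simp add: algebra_simps add_divide_distrib)
    thus ?thesis by (simp only: rGamma_plus1)
  qed
  ultimately have "?c \<nu> sums ((\<nu> + 1) * bessel_series (\<nu> + 1) z + z * bessel_series (\<nu> + 2) z)"
    by simp
  thus ?thesis using sums[OF assms] sums_unique2 by blast
qed

lemma bessel_I_eq_bessel_series:
  assumes "x > 0" and "\<alpha> > -1"
  shows "bessel_I \<alpha> x = (x / 2) powr \<alpha> * bessel_series \<alpha> (x\<^sup>2 / 4)"
proof -
  have "(x / 2) powr (2 * real k + \<alpha>) / (fact k * Gamma (real k + \<alpha> + 1)) =
        (x / 2) powr \<alpha> * (rGamma (real k + \<alpha> + 1) / fact k * (x\<^sup>2 / 4) ^ k)" for k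
  proof -
    have "(x / 2) powr (2 * real k) = (x / 2) ^ (2 * k)"
      using assms(1) powr_realpow[of "x / 2" "2 * k"] by simp
    also have "\<dots> = (x\<^sup>2 / 4) ^ k" by (simp add: power_mult power_divide)
    finally have "(x / 2) powr (2 * real k + \<alpha>) = (x / 2) powr \<alpha> * (x\<^sup>2 / 4) ^ k"
      by (simp add: powr_add)
    thus ?thesis by (simp only: rGamma_inverse_Gamma divide_inverse inverse_mult_distrib mult_ac)
  qed
  thus ?thesis unfolding bessel_I_def bessel_series_def
    by (simp only: suminf_mult[OF bessel_series_summable[OF assms(2)]])
qed

section \<open>Comparison of consecutive orders\<close>

text \<open>
  This is \<open>I\<^sub>\<nu>\<^sub>+\<^sub>1 x \<le> I\<^sub>\<nu> x\<close>. The difference \<open>d\<close> of the two sides satisfies the linear equation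
  \<open>d' + (1 + 2\<nu> / x) * d = r\<close> with a nonnegative remainder \<open>r\<close>, so multiplying by the integrating factor
  \<open>exp x * x powr (2 * \<nu>)\<close> gives an increasing function; for \<open>\<nu> > 0\<close> it vanishes at 0.
\<close>

lemma bessel_series_order_antimono:
  assumes "\<nu> > 0" and "x > 0"
  shows "x / 2 * bessel_series (\<nu> + 1) (x\<^sup>2 / 4) \<le> bessel_series \<nu> (x\<^sup>2 / 4)"
proof -
  let ?b = "\<lambda>k t. bessel_series (\<nu> + k) (t\<^sup>2 / 4)"
  define w where "w t = exp t * t powr (2 * \<nu>) * (?b 0 t - t / 2 * ?b 1 t)" for t
  have "w 0 \<le> w x"
  proof (rule DERIV_nonneg_imp_increasing_open[of 0 x w])
    show "0 \<le> x" using assms by simp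
    show "continuous_on {0..x} w" unfolding w_def
      using assms by (intro continuous_intros continuous_on_powr') auto
    fix t :: real assume t: "0 < t" "t < x"
    have rec: "?b 2 t * t\<^sup>2 / 4 = ?b 0 t - (\<nu> + 1) * ?b 1 t"
      using bessel_series_recurrence[of \<nu> "t\<^sup>2 / 4"] assms by (simp add: mult_ac)
    have p1: "t powr (2 * \<nu> - 1) = t powr (2 * \<nu>) / t" using t by (simp add: powr_diff)
    have "(w has_real_derivative exp t * t powr (2 * \<nu>) *
        ((1 + 2 * \<nu> / t) * (?b 0 t - t / 2 * ?b 1 t) +
         (t / 2 * ?b 1 t - ?b 1 t / 2 - ?b 2 t * t\<^sup>2 / 4))) (at t)"
      unfolding w_def using t assms
      by (auto intro!: derivative_eq_intros simp: p1 add_ac)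
         (simp add: field_simps power2_eq_square)
    also have "(1 + 2 * \<nu> / t) * (?b 0 t - t / 2 * ?b 1 t) +
         (t / 2 * ?b 1 t - ?b 1 t / 2 - ?b 2 t * t\<^sup>2 / 4) = 2 * \<nu> * ?b 0 t / t + ?b 1 t / 2"
      unfolding rec using t by (simp add: field_simps)
    finally have "(w has_real_derivative exp t * t powr (2 * \<nu>) * (2 * \<nu> * ?b 0 t / t + ?b 1 t / 2)) (at t)" .
    moreover have "exp t * t powr (2 * \<nu>) * (2 * \<nu> * ?b 0 t / t + ?b 1 t / 2) \<ge> 0"
      using t assms by (intro mult_nonneg_nonneg add_nonneg_nonneg divide_nonneg_nonneg bessel_series_nonneg) auto
    ultimately show "\<exists>y. (w has_real_derivative y) (at t) \<and> 0 \<le> y" by blast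
  qed
  hence "0 \<le> exp x * x powr (2 * \<nu>) * (?b 0 x - x / 2 * ?b 1 x)"
    using assms by (simp add: w_def)
  moreover have "0 < exp x * x powr (2 * \<nu>)" using assms by simp
  ultimately have "0 \<le> ?b 0 x - x / 2 * ?b 1 x"
    by (simp only: zero_le_mult_iff) linarith
  thus ?thesis by simp
qed

text \<open>
  In terms of Bessel functions, \<open>I\<^sub>\<nu>\<^sub>+\<^sub>1 x / I\<^sub>\<nu> x \<ge> x / (x + 2\<nu> + 2)\<close>: in the three-term recurrence, replace
  \<open>I\<^sub>\<nu>\<^sub>+\<^sub>2\<close> by the larger \<open>I\<^sub>\<nu>\<^sub>+\<^sub>1\<close>. Monotonicity in the order is applied at \<open>\<nu> + 1 > 0\<close>.
\<close>

lemma bessel_series_ratio_lower: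
  assumes "\<nu> > -1" and "x > 0"
  shows "bessel_series \<nu> (x\<^sup>2 / 4) \<le> (\<nu> + 1 + x / 2) * bessel_series (\<nu> + 1) (x\<^sup>2 / 4)"
proof -
  have "x / 2 * (x / 2 * bessel_series (\<nu> + 2) (x\<^sup>2 / 4)) \<le> x / 2 * bessel_series (\<nu> + 1) (x\<^sup>2 / 4)"
    using bessel_series_order_antimono[of "\<nu> + 1" x] assms
    by (intro mult_left_mono) (auto simp: add_ac)
  thus ?thesis
    using bessel_series_recurrence[OF assms(1), of "x\<^sup>2 / 4"]
    by (simp add: algebra_simps power2_eq_square)
qed

section \<open>A single power weight\<close>

text \<open>
  Derivatives and their continuity are asked for in the open interval only, because for \<open>q < 0\<close> the derivative of
  \<open>t powr (q + 1)\<close> is unbounded at 0.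
\<close>

lemma nn_integral_le_increment:
  fixes p G G' :: "real \<Rightarrow> real"
  assumes "a \<le> b" and G: "continuous_on {a..b} G"
    and deriv: "\<And>t. a < t \<Longrightarrow> t < b \<Longrightarrow> (G has_real_derivative G' t) (at t)"
    and cont: "continuous_on {a<..<b} G'"
    and p: "\<And>t. a < t \<Longrightarrow> t < b \<Longrightarrow> 0 \<le> G' t \<and> p t \<le> G' t"
  shows "(\<integral>\<^sup>+t\<in>{a<..<b}. ennreal (p t) \<partial>lborel) \<le> ennreal (G b - G a)"
proof (cases "a = b")
  case False
  hence ab: "a < b" using assms(1) by simp
  have lims: "(G \<longlongrightarrow> G a) (at_right a)" "(G \<longlongrightarrow> G b) (at_left b)"
    using G ab by (auto simp: continuous_on_Icc_at_rightD continuous_on_Icc_at_leftD)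
  have isc: "isCont G' t" if "a < t" "t < b" for t
    using cont that by (simp add: continuous_on_eq_continuous_at)
  have e: "einterval (ereal a) (ereal b) = {a<..<b}" by (auto simp: einterval_def)
  have *: "set_integrable lborel (einterval (ereal a) (ereal b)) G'"
    "(LBINT t=ereal a..ereal b. G' t) = G b - G a"
    using ab deriv isc p lims
    by (intro interval_integral_FTC_nonneg[where F = G];
        auto simp: ereal_tendsto_simps intro!: AE_I2)+
  have I: "integrable lborel (\<lambda>t. indicator {a<..<b} t *\<^sub>R G' t)"
    using *(1) by (simp add: set_integrable_def e)
  have "(\<integral>\<^sup>+t\<in>{a<..<b}. ennreal (p t) \<partial>lborel) \<le>
        (\<integral>\<^sup>+t. ennreal (indicator {a<..<b} t *\<^sub>R G' t) \<partial>lborel)"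
    using p by (intro nn_integral_mono) (auto simp: indicator_def intro!: ennreal_leI)
  also have "\<dots> = ennreal (\<integral>t. indicator {a<..<b} t *\<^sub>R G' t \<partial>lborel)"
    using p by (intro nn_integral_eq_integral I) (auto simp: indicator_def)
  also have "(\<integral>t. indicator {a<..<b} t *\<^sub>R G' t \<partial>lborel) = G b - G a"
    using *(2) ab by (simp add: interval_lebesgue_integral_def set_lebesgue_integral_def e)
  finally show ?thesis .
qed simp

lemma X_const_lower: "2 * (\<mu> + 2) * \<theta> / (1 - \<theta>) \<le> X_const \<mu> q \<theta>"
  by (simp add: X_const_def)

text \<open>
  The case of a point mass at \<open>q\<close>, with the common factor \<open>2 powr (-\<mu>)\<close> cancelled. In the
  proof \<open>S\<close> is \<open>t powr (q - \<mu>) * I\<^sub>\<mu>\<^sub>+\<^sub>1 t\<close> without that factor, written so that it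
  is visibly continuous at 0, \<open>H\<close> is the same with the exponential, and \<open>D\<close> and \<open>H'\<close> are
  their derivatives. The two halves of \<open>M_const\<close> serve the ranges up to \<open>X\<close> and beyond \<open>X\<close>; since
  \<open>H\<close> increases beyond \<open>X\<close>, the larger of the two serves for both together.
\<close>

lemma power_weight_bound:
  fixes \<mu> q \<gamma> \<theta> x :: real
  assumes \<mu>: "\<mu> > -1" and q: "q > -1" and \<gamma>: "0 < \<gamma>" "\<gamma> < \<theta>" "\<theta> < 1" and x: "x > 0"
  shows "(\<integral>\<^sup>+t\<in>{0<..<x}. ennreal (exp (- \<gamma> * t) * t powr q * bessel_series \<mu> (t\<^sup>2 / 4)) \<partial>lborel)
     \<le> ennreal (M_const \<mu> q \<gamma> \<theta> *
         (exp (- \<gamma> * x) * x powr q * (x / 2 * bessel_series (\<mu> + 1) (x\<^sup>2 / 4))))"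
proof -
  define b0 b1 b2 where "b0 t = bessel_series \<mu> (t\<^sup>2 / 4)"
    and "b1 t = bessel_series (\<mu> + 1) (t\<^sup>2 / 4)"
    and "b2 t = bessel_series (\<mu> + 2) (t\<^sup>2 / 4)" for t :: real
  define p where "p t = exp (- \<gamma> * t) * t powr q * b0 t" for t
  define S where "S t = t powr (q + 1) * b1 t / 2" for t
  define H where "H t = exp (- \<gamma> * t) * S t" for t
  define D where "D t = t powr q * ((q + 1) / 2 * b1 t + t\<^sup>2 / 4 * b2 t)" for t
  define H' where "H' t = exp (- \<gamma> * t) * t powr q *
      ((q + 1) / 2 * b1 t + t\<^sup>2 / 4 * b2 t - \<gamma> * (t / 2 * b1 t))" for t
  define X where "X = X_const \<mu> q \<theta>"
  define K where "K = K_const \<mu> q"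
  define M where "M = M_const \<mu> q \<gamma> \<theta>"
  define C where "C = 1 / (beta_const \<mu> q \<theta> * (\<theta> - \<gamma>))"
  have nn: "b0 t \<ge> 0" "b1 t \<ge> 0" "b2 t \<ge> 0" for t
    unfolding b0_def b1_def b2_def using \<mu> by (auto intro!: bessel_series_nonneg)
  have rec: "b0 t = (\<mu> + 1) * b1 t + t\<^sup>2 / 4 * b2 t" for t
    unfolding b0_def b1_def b2_def by (rule bessel_series_recurrence[OF \<mu>])
  have S_deriv: "(S has_real_derivative D t) (at t)" if "t > 0" for t
  proof -
    have pw: "t powr (q + 1) = t powr q * t" using that by (simp add: powr_add)
    show ?thesis unfolding S_def D_def b1_def b2_def using that \<mu>
      by (auto intro!: derivative_eq_intros simp: pw add_ac)
         (simp add: field_simps power2_eq_square powr_add)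
  qed
  have H_deriv: "(H has_real_derivative H' t) (at t)" if "t > 0" for t
  proof -
    have "((\<lambda>t. exp (- \<gamma> * t)) has_real_derivative - \<gamma> * exp (- \<gamma> * t)) (at t)"
      by (auto intro!: derivative_eq_intros)
    from DERIV_mult[OF this S_deriv[OF that]]
    show ?thesis unfolding H_def
      by (rule DERIV_cong) (use that in \<open>simp add: D_def H'_def S_def powr_add algebra_simps\<close>)
  qed
  have cS: "continuous_on {0..} S"
    unfolding S_def b1_def using \<mu> q by (intro continuous_intros continuous_on_powr') auto
  have cH: "continuous_on {0..} H"
    unfolding H_def by (intro continuous_intros cS)
  have cD: "continuous_on {0<..} D"
    unfolding D_def b1_def b2_def using \<mu> by (intro continuous_intros) auto
  have cH': "continuous_on {0<..} H'"
    unfolding H'_def b1_def b2_def using \<mu> by (intro continuous_intros) auto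
  have K1: "K \<ge> 1" and K2: "\<mu> + 1 \<le> K * ((q + 1) / 2)"
  proof -
    show "K \<ge> 1" by (simp add: K_def K_const_def)
    have "2 * (\<mu> + 1) / (q + 1) \<le> K" by (simp add: K_def K_const_def)
    thus "\<mu> + 1 \<le> K * ((q + 1) / 2)" using q by (simp add: field_simps)
  qed
  have X0: "0 < X" and Xlow: "\<theta> * (2 * \<mu> + 4) \<le> (1 - \<theta>) * X"
  proof -
    have l: "2 * (\<mu> + 2) * \<theta> / (1 - \<theta>) \<le> X" unfolding X_def by (rule X_const_lower)
    have "0 < 2 * (\<mu> + 2) * \<theta> / (1 - \<theta>)" using \<mu> \<gamma> by simp
    with l show "0 < X" by linarith
    show "\<theta> * (2 * \<mu> + 4) \<le> (1 - \<theta>) * X" using l \<gamma> by (simp add: field_simps)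
  qed
  have S_nonneg: "S t \<ge> 0" for t unfolding S_def using nn by simp
  have H_nonneg: "H t \<ge> 0" for t unfolding H_def using S_nonneg by simp
  have near: "(\<integral>\<^sup>+t\<in>{0<..<y}. ennreal (p t) \<partial>lborel) \<le> ennreal (M * H y)"
    if y: "0 < y" "y \<le> X" for y
  proof -
    have "(\<integral>\<^sup>+t\<in>{0<..<y}. ennreal (p t) \<partial>lborel) \<le> ennreal (K * S y - K * S 0)"
    proof (rule nn_integral_le_increment[where G = "\<lambda>t. K * S t" and G' = "\<lambda>t. K * D t"])
      show "continuous_on {0..y} (\<lambda>t. K * S t)"
        by (intro continuous_intros continuous_on_subset[OF cS]) auto
      show "continuous_on {0<..<y} (\<lambda>t. K * D t)"
        by (intro continuous_intros continuous_on_subset[OF cD]) auto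
      fix t assume t: "0 < t" "t < y"
      show "((\<lambda>t. K * S t) has_real_derivative K * D t) (at t)"
        using DERIV_cmult[OF S_deriv[OF t(1)]] .
      have "(\<mu> + 1) * b1 t \<le> K * ((q + 1) / 2) * b1 t"
        using K2 nn by (intro mult_right_mono) auto
      moreover have "1 * (t\<^sup>2 / 4 * b2 t) \<le> K * (t\<^sup>2 / 4 * b2 t)"
        using K1 nn by (intro mult_right_mono) auto
      ultimately have "b0 t \<le> K * ((q + 1) / 2 * b1 t + t\<^sup>2 / 4 * b2 t)"
        unfolding rec[of t] by (simp only: distrib_left mult.assoc mult_1)
      hence "t powr q * b0 t \<le> t powr q * (K * ((q + 1) / 2 * b1 t + t\<^sup>2 / 4 * b2 t))"
        by (intro mult_left_mono) auto
      hence A: "t powr q * b0 t \<le> K * D t" by (simp add: D_def mult_ac)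
      have "exp (- \<gamma> * t) * (t powr q * b0 t) \<le> 1 * (t powr q * b0 t)"
        using t \<gamma> nn by (intro mult_right_mono) auto
      moreover have "0 \<le> t powr q * b0 t" using nn by simp
      ultimately show "0 \<le> K * D t \<and> p t \<le> K * D t"
        using A by (simp add: p_def mult.assoc)
    qed (use y in auto)
    also have "K * S y - K * S 0 = K * S y" by (simp add: S_def)
    also have "K * S y = K * exp (\<gamma> * y) * H y"
      by (simp add: H_def exp_minus)
    also have "\<dots> \<le> M * H y"
    proof (intro mult_right_mono H_nonneg)
      have "K * exp (\<gamma> * y) \<le> K * exp (\<gamma> * X)"
        using y \<gamma> K1 by (intro mult_left_mono) auto
      also have "\<dots> \<le> M" by (simp add: M_def M_const_def K_def X_def)
      finally show "K * exp (\<gamma> * y) \<le> M" .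
    qed
    finally show ?thesis by (simp add: ennreal_leI)
  qed
  have \<beta>: "beta_const \<mu> q \<theta> = X / (X + 2 * \<mu> + 2)" by (simp add: beta_const_def X_def)
  have beta_pos: "0 < beta_const \<mu> q \<theta>" unfolding \<beta> using X0 \<mu> by simp
  have far: "p t \<le> C * H' t" "0 \<le> H' t" if t: "t > X" for t
  proof -
    have t0: "t > 0" using t X0 by linarith
    \<comment> \<open>The ratio bound one order up; the size of \<open>X\<close> turns it into \<open>h \<ge> \<theta> g\<close>.\<close>
    have "b1 t \<le> (\<mu> + 2 + t / 2) * b2 t"
      using bessel_series_ratio_lower[of "\<mu> + 1" t] \<mu> t0 by (simp add: b1_def b2_def add_ac)
    hence "\<theta> * b1 t \<le> \<theta> * (\<mu> + 2 + t / 2) * b2 t" using \<gamma> by (simp add: mult.assoc)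
    also have "\<dots> \<le> t / 2 * b2 t"
    proof (intro mult_right_mono nn)
      have "(1 - \<theta>) * X \<le> (1 - \<theta>) * t" using t \<gamma> by (intro mult_left_mono) auto
      thus "\<theta> * (\<mu> + 2 + t / 2) \<le> t / 2" using Xlow by (simp add: algebra_simps)
    qed
    finally have "t / 2 * (\<theta> * b1 t) \<le> t / 2 * (t / 2 * b2 t)"
      using t0 by (intro mult_left_mono) auto
    hence A: "\<theta> * (t / 2 * b1 t) \<le> t\<^sup>2 / 4 * b2 t"
      by (simp add: power2_eq_square mult_ac)
    \<comment> \<open>The value \<open>\<beta>\<close> is the lower ratio bound at \<open>X\<close>, and that bound increases with \<open>t\<close>.\<close>
    have "beta_const \<mu> q \<theta> * (\<mu> + 1 + t / 2) \<le> t / 2"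
    proof -
      have "X * (2 * \<mu> + 2) \<le> t * (2 * \<mu> + 2)" using t \<mu> by (intro mult_right_mono) auto
      thus ?thesis unfolding \<beta> using X0 \<mu> by (simp add: field_simps)
    qed
    hence "beta_const \<mu> q \<theta> * (\<mu> + 1 + t / 2) * b1 t \<le> t / 2 * b1 t"
      by (intro mult_right_mono nn)
    moreover have "beta_const \<mu> q \<theta> * b0 t \<le> beta_const \<mu> q \<theta> * ((\<mu> + 1 + t / 2) * b1 t)"
      using bessel_series_ratio_lower[OF \<mu> t0] beta_pos
      by (intro mult_left_mono) (auto simp: b0_def b1_def)
    ultimately have "beta_const \<mu> q \<theta> * b0 t \<le> t / 2 * b1 t"
      by (simp add: mult.assoc)
    hence "(\<theta> - \<gamma>) * (beta_const \<mu> q \<theta> * b0 t) \<le> (\<theta> - \<gamma>) * (t / 2 * b1 t)"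
      using \<gamma> by (intro mult_left_mono) auto
    also have "\<dots> \<le> (q + 1) / 2 * b1 t + t\<^sup>2 / 4 * b2 t - \<gamma> * (t / 2 * b1 t)"
    proof -
      have "0 \<le> (q + 1) / 2 * b1 t" using q nn by simp
      thus ?thesis unfolding left_diff_distrib using A by linarith
    qed
    finally have B: "exp (- \<gamma> * t) * t powr q * ((\<theta> - \<gamma>) * (beta_const \<mu> q \<theta> * b0 t)) \<le> H' t"
      unfolding H'_def by (intro mult_left_mono) auto
    thus "0 \<le> H' t" by (rule order_trans[rotated]) (use beta_pos \<gamma> nn in auto)
    from B show "p t \<le> C * H' t"
      unfolding C_def p_def using beta_pos \<gamma> by (simp add: field_simps)
  qed
  have C0: "0 < C" unfolding C_def using beta_pos \<gamma> by simp
  have CM: "C \<le> M" by (simp add: C_def M_def M_const_def)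
  have "(\<integral>\<^sup>+t\<in>{0<..<x}. ennreal (p t) \<partial>lborel) \<le> ennreal (M * H x)"
  proof (cases "x \<le> X")
    case True
    thus ?thesis using near x by simp
  next
    case False
    hence Xx: "X < x" by simp
    have pm: "p \<in> borel_measurable borel"
    proof -
      note [measurable] = borel_measurable_bessel_series[OF \<mu>]
      show ?thesis unfolding p_def b0_def by measurable
    qed
    have "(\<integral>\<^sup>+t\<in>{0<..<x}. ennreal (p t) \<partial>lborel)
        = (\<integral>\<^sup>+t. ennreal (p t) * indicator {0<..<X} t + ennreal (p t) * indicator {X<..<x} t \<partial>lborel)"
      using AE_lborel_singleton[of X] Xx X0
      by (intro nn_integral_cong_AE) (auto elim!: eventually_mono simp: indicator_def)
    also have "\<dots> = (\<integral>\<^sup>+t\<in>{0<..<X}. ennreal (p t) \<partial>lborel) + (\<integral>\<^sup>+t\<in>{X<..<x}. ennreal (p t) \<partial>lborel)"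
      using pm by (intro nn_integral_add) auto
    also have "\<dots> \<le> ennreal (M * H X) + ennreal (C * H x - C * H X)"
    proof (intro add_mono near nn_integral_le_increment[where G' = "\<lambda>t. C * H' t"])
      show "continuous_on {X..x} (\<lambda>t. C * H t)"
        using X0 by (intro continuous_intros continuous_on_subset[OF cH]) auto
      show "continuous_on {X<..<x} (\<lambda>t. C * H' t)"
        using X0 by (intro continuous_intros continuous_on_subset[OF cH']) auto
      show "((\<lambda>t. C * H t) has_real_derivative C * H' t) (at t)" if "X < t" for t
        using DERIV_cmult[OF H_deriv] that X0 by simp
    qed (use far X0 Xx C0 in auto)
    also have "\<dots> \<le> ennreal (M * H x)"
    proof -
      have inc: "H X \<le> H x"
      proof (rule DERIV_nonneg_imp_increasing_open[of X x H])
        show "continuous_on {X..x} H" using X0 by (intro continuous_on_subset[OF cH]) auto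
        show "\<exists>y. (H has_real_derivative y) (at t) \<and> 0 \<le> y" if "X < t" "t < x" for t
          using H_deriv[of t] far(2)[of t] that X0 by auto
      qed (use Xx in auto)
      hence "C * (H x - H X) \<le> M * (H x - H X)" using CM by (intro mult_right_mono) auto
      moreover have "0 \<le> C * (H x - H X)" using C0 inc by simp
      moreover have "0 \<le> M * H X" using C0 CM H_nonneg by simp
      ultimately show ?thesis
        by (subst ennreal_plus[symmetric]) (auto simp: algebra_simps intro!: ennreal_leI)
    qed
    finally show ?thesis .
  qed
  moreover have "H x = exp (- \<gamma> * x) * x powr q * (x / 2 * b1 x)"
    using x by (simp add: H_def S_def powr_add)
  ultimately show ?thesis
    unfolding p_def M_def b0_def b1_def by simp
qed

section \<open>Dependence of the constants on the exponent\<close>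

lemma K_const_antimono:
  assumes "\<mu> > -1" "-1 < q" "q \<le> r"
  shows "K_const \<mu> r \<le> K_const \<mu> q"
proof -
  have "2 * (\<mu> + 1) / (r + 1) \<le> 2 * (\<mu> + 1) / (q + 1)"
    using assms by (intro divide_left_mono) auto
  thus ?thesis unfolding K_const_def by linarith
qed

text \<open>
  For negative exponents both \<open>(2\<mu> + 2) * \<theta> - q \<ge> 0\<close> and the product \<open>-4 * (1 - \<theta>) * q * (2\<mu> + 2)\<close> decrease
  as \<open>q\<close> grows; for nonnegative exponents the value is the common lower bound.
\<close>

lemma X_const_antimono:
  assumes "\<mu> > -1" "0 < \<theta>" "\<theta> < 1" "q \<le> r"
  shows "X_const \<mu> r \<theta> \<le> X_const \<mu> q \<theta>"
proof (cases "r < 0")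
  case True
  let ?A = "\<lambda>q. (2 * \<mu> + 2) * \<theta> - q"
  have "0 \<le> (2 * \<mu> + 2) * \<theta>" using assms by simp
  hence "0 \<le> ?A r" using True by linarith
  moreover have Aqr: "?A r \<le> ?A q" using assms by simp
  ultimately have "(?A r)\<^sup>2 \<le> (?A q)\<^sup>2" by (intro power_mono) auto
  moreover have "4 * (1 - \<theta>) * (2 * \<mu> + 2) * q \<le> 4 * (1 - \<theta>) * (2 * \<mu> + 2) * r"
    using assms by (intro mult_left_mono) auto
  ultimately have "(?A r)\<^sup>2 - 4 * (1 - \<theta>) * r * (2 * \<mu> + 2) \<le> (?A q)\<^sup>2 - 4 * (1 - \<theta>) * q * (2 * \<mu> + 2)"
    by (simp only: mult_ac)
  hence "(?A r + sqrt ((?A r)\<^sup>2 - 4 * (1 - \<theta>) * r * (2 * \<mu> + 2))) / (2 * (1 - \<theta>))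
       \<le> (?A q + sqrt ((?A q)\<^sup>2 - 4 * (1 - \<theta>) * q * (2 * \<mu> + 2))) / (2 * (1 - \<theta>))"
    using assms Aqr by (intro divide_right_mono add_mono) auto
  thus ?thesis using True assms(4) unfolding X_const_def by auto
next
  case False
  thus ?thesis using X_const_lower[of \<mu> \<theta> q] by (simp add: X_const_def)
qed

text \<open>
  The two entries of the maximum move in opposite directions: the first one is largest at the left end, where \<open>K\<close>
  and \<open>X\<close> are largest, whereas the second one is largest where \<open>X\<close> is smallest.
\<close>

lemma M_const_bdd_above:
  assumes "\<mu> > -1" "-1 < qm" "0 < \<gamma>" "\<gamma> < \<theta>" "\<theta> < 1"
  shows "bdd_above ((\<lambda>q. M_const \<mu> q \<gamma> \<theta>) ` {qm..qp})"
proof (rule bdd_aboveI2)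
  fix q assume q: "q \<in> {qm..qp}"
  let ?X0 = "2 * (\<mu> + 2) * \<theta> / (1 - \<theta>)"
  have X0: "0 < ?X0" using assms by simp
  have le: "?X0 \<le> X_const \<mu> q \<theta>" by (rule X_const_lower)
  have "X_const \<mu> q \<theta> \<le> X_const \<mu> qm \<theta>" using assms q by (intro X_const_antimono) auto
  hence "K_const \<mu> q * exp (\<gamma> * X_const \<mu> q \<theta>) \<le> K_const \<mu> qm * exp (\<gamma> * X_const \<mu> qm \<theta>)"
    using assms q by (intro mult_mono K_const_antimono) (auto simp: K_const_def)
  moreover have "?X0 / (?X0 + 2 * \<mu> + 2) \<le> beta_const \<mu> q \<theta>"
  proof -
    have "?X0 * (2 * \<mu> + 2) \<le> X_const \<mu> q \<theta> * (2 * \<mu> + 2)"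
      using le assms by (intro mult_right_mono) auto
    hence "?X0 * (X_const \<mu> q \<theta> + 2 * \<mu> + 2) \<le> X_const \<mu> q \<theta> * (?X0 + 2 * \<mu> + 2)"
      by (simp only: distrib_left distrib_right) (simp add: mult_ac)
    moreover have "0 < ?X0 + 2 * \<mu> + 2" "0 < X_const \<mu> q \<theta> + 2 * \<mu> + 2"
      using X0 le assms by linarith+
    ultimately show ?thesis unfolding beta_const_def
      by (subst frac_le_eq) (auto intro!: divide_nonpos_pos simp: mult_ac)
  qed
  hence "1 / (beta_const \<mu> q \<theta> * (\<theta> - \<gamma>)) \<le> 1 / (?X0 / (?X0 + 2 * \<mu> + 2) * (\<theta> - \<gamma>))"
  proof (intro divide_left_mono mult_right_mono mult_pos_pos)
    have 0: "0 < ?X0 / (?X0 + 2 * \<mu> + 2)" using X0 assms by (intro divide_pos_pos[of ?X0]) linarith+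
    show "0 < ?X0 / (?X0 + 2 * \<mu> + 2)" by (rule 0)
    show "0 < beta_const \<mu> q \<theta>" if "?X0 / (?X0 + 2 * \<mu> + 2) \<le> beta_const \<mu> q \<theta>"
      using 0 that by linarith
  qed (use assms in auto)
  ultimately show "M_const \<mu> q \<gamma> \<theta> \<le> max (K_const \<mu> qm * exp (\<gamma> * X_const \<mu> qm \<theta>))
      (1 / (?X0 / (?X0 + 2 * \<mu> + 2) * (\<theta> - \<gamma>)))"
    unfolding M_const_def by linarith
qed

lemma M_const_antimono_nonneg:
  assumes "\<mu> > -1" "0 \<le> q" "q \<le> r"
  shows "M_const \<mu> r \<gamma> \<theta> \<le> M_const \<mu> q \<gamma> \<theta>"
proof -
  have X: "X_const \<mu> r \<theta> = X_const \<mu> q \<theta>" using assms by (simp add: X_const_def)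
  have "K_const \<mu> r * exp (\<gamma> * X_const \<mu> q \<theta>) \<le> K_const \<mu> q * exp (\<gamma> * X_const \<mu> q \<theta>)"
    using assms by (intro mult_right_mono K_const_antimono) auto
  thus ?thesis unfolding M_const_def beta_const_def X by linarith
qed

lemma M_const_nonneg: "0 \<le> M_const \<mu> q \<gamma> \<theta>"
  by (auto simp: M_const_def K_const_def le_max_iff_disj)

section \<open>Mixtures of power weights\<close>

text \<open>
  On a compact range of exponents \<open>t powr q\<close> is at most \<open>t powr qm + t powr qp\<close>, whether
  \<open>t\<close> is below or above 1. So the Bochner integral in \<open>W_mix\<close> is a genuine one and may be exchanged with the
  nonnegative integral that Tonelli's theorem handles.
\<close>

lemma ennreal_W_mix:
  assumes "finite_measure \<sigma>" and s: "sets \<sigma> = sets (restrict_space borel {qm..qp})" and "t > 0"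
  shows "ennreal (W_mix \<sigma> t) = (\<integral>\<^sup>+q. ennreal (t powr q) \<partial>\<sigma>)"
proof -
  interpret finite_measure \<sigma> by fact
  have sp: "space \<sigma> = {qm..qp}" using sets_eq_imp_space_eq[OF s] by (simp add: space_restrict_space)
  have id: "(\<lambda>q. q) \<in> borel_measurable \<sigma>"
    unfolding measurable_cong_sets[OF s refl] by (intro measurable_restrict_space1) simp
  have "t powr q \<le> t powr qm + t powr qp" if "q \<in> {qm..qp}" for q
  proof (cases "t \<ge> 1")
    case True
    hence "t powr q \<le> t powr qp" using that by (intro powr_mono) auto
    thus ?thesis by (simp add: add_increasing)
  next
    case False
    hence "t powr q \<le> t powr qm" using that assms(3) by (intro powr_mono') auto
    thus ?thesis by (simp add: add_increasing2)
  qed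
  hence "integrable \<sigma> (\<lambda>q. t powr q)"
    using id sp by (intro integrable_const_bound[where B = "t powr qm + t powr qp"])
      (auto intro!: AE_I2)
  thus ?thesis unfolding W_mix_def by (subst nn_integral_eq_integral) auto
qed

lemma W_mix_nonneg: "0 \<le> W_mix \<sigma> t"
  unfolding W_mix_def by (intro integral_nonneg_AE) auto

theorem theorem8p1:
  fixes \<mu> \<gamma> \<theta> qm qp :: real and \<sigma> :: "real measure"
  assumes "\<mu> > -1" and "0 < \<gamma>" and "\<gamma> < 1"
    and "-1 < qm" and "qm \<le> qp"
    and "finite_measure \<sigma>" and "sets \<sigma> = sets (restrict_space borel {qm..qp})"
    and "\<gamma> < \<theta>" and "\<theta> < 1"
  shows "(\<forall>x>0.
            set_integrable lborel {0<..<x}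
              (\<lambda>t. exp (- \<gamma> * t) * W_mix \<sigma> t * t powr (- \<mu>) * bessel_I \<mu> t) \<and>
            (LINT t:{0<..<x}|lborel.
               exp (- \<gamma> * t) * W_mix \<sigma> t * t powr (- \<mu>) * bessel_I \<mu> t)
              \<le> M_sup \<mu> {qm..qp} \<gamma> \<theta> *
                 (exp (- \<gamma> * x) * W_mix \<sigma> x * x powr (- \<mu>) * bessel_I (\<mu> + 1) x)) \<and>
         bdd_above ((\<lambda>q. M_const \<mu> q \<gamma> \<theta>) ` {qm..qp}) \<and>
         ({qm..qp} \<subseteq> {0..} \<longrightarrow> M_sup \<mu> {qm..qp} \<gamma> \<theta> = M_const \<mu> qm \<gamma> \<theta>)"
proof (intro conjI allI impI)
  have bdd: "bdd_above ((\<lambda>q. M_const \<mu> q \<gamma> \<theta>) ` {qm..qp})"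
    using assms by (intro M_const_bdd_above) auto
  thus "bdd_above ((\<lambda>q. M_const \<mu> q \<gamma> \<theta>) ` {qm..qp})" .
  show "M_sup \<mu> {qm..qp} \<gamma> \<theta> = M_const \<mu> qm \<gamma> \<theta>" if "{qm..qp} \<subseteq> {0..}"
    unfolding M_sup_def using that assms
    by (intro cSup_eq_maximum) (auto intro!: M_const_antimono_nonneg)
  define M where "M = M_sup \<mu> {qm..qp} \<gamma> \<theta>"
  have M_upper: "M_const \<mu> q \<gamma> \<theta> \<le> M" if "q \<in> {qm..qp}" for q
    unfolding M_def M_sup_def by (rule cSUP_upper[OF that bdd])
  have M_nonneg: "0 \<le> M"
    using M_upper[of qm] M_const_nonneg[of \<mu> qm \<gamma> \<theta>] assms(5) by simp
  interpret \<sigma>: finite_measure \<sigma> by fact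
  interpret pair_sigma_finite lborel \<sigma> ..
  have sp: "space \<sigma> = {qm..qp}"
    using sets_eq_imp_space_eq[OF assms(7)] by (simp add: space_restrict_space)
  have id: "(\<lambda>q. q) \<in> borel_measurable \<sigma>"
    unfolding measurable_cong_sets[OF assms(7) refl] by (intro measurable_restrict_space1) simp
  have powr_meas: "(\<lambda>q. ennreal (t powr q)) \<in> borel_measurable \<sigma>" for t
  proof -
    note [measurable] = id
    show ?thesis by measurable
  qed
  note [measurable] = borel_measurable_bessel_series[OF assms(1)]
  have Wm [measurable]: "W_mix \<sigma> \<in> borel_measurable borel"
  proof -
    note [measurable] = id
    show ?thesis unfolding W_mix_def by measurable
  qed
  fix x :: real assume x: "x > 0"
  let ?g = "\<lambda>t. exp (- \<gamma> * t) * W_mix \<sigma> t * t powr (- \<mu>) * bessel_I \<mu> t"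
  let ?e = "\<lambda>t. exp (- \<gamma> * t) * bessel_series \<mu> (t\<^sup>2 / 4)"
  define R where "R = exp (- \<gamma> * x) * (x / 2 * bessel_series (\<mu> + 1) (x\<^sup>2 / 4))"
  have R_nonneg: "0 \<le> R" unfolding R_def using x assms(1)
    by (intro mult_nonneg_nonneg bessel_series_nonneg) auto
  have e_nonneg: "0 \<le> ?e t" for t using assms(1) by (simp add: bessel_series_nonneg)
  \<comment> \<open>The integrand over \<open>(0, x)\<close> without the factor \<open>2 powr (-\<mu>)\<close>. A bound on its nonnegative integral
     yields both the integrability and the inequality.\<close>
  define F where "F t = indicator {0<..<x} t * (W_mix \<sigma> t * ?e t)" for t
  have F_meas: "F \<in> borel_measurable lborel" unfolding F_def by measurable
  have F_nonneg: "0 \<le> F t" for t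
    unfolding F_def by (rule mult_nonneg_nonneg[OF _ mult_nonneg_nonneg[OF W_mix_nonneg e_nonneg]]) simp
  have "(\<integral>\<^sup>+t. ennreal (F t) \<partial>lborel) =
      (\<integral>\<^sup>+t. (\<integral>\<^sup>+q. ennreal (exp (- \<gamma> * t) * t powr q * bessel_series \<mu> (t\<^sup>2 / 4)) *
          indicator {0<..<x} t \<partial>\<sigma>) \<partial>lborel)"
  proof (intro nn_integral_cong)
    fix t :: real
    show "ennreal (F t) = (\<integral>\<^sup>+q. ennreal (exp (- \<gamma> * t) * t powr q * bessel_series \<mu> (t\<^sup>2 / 4)) *
          indicator {0<..<x} t \<partial>\<sigma>)"
    proof (cases "t \<in> {0<..<x}")
      case True
      have "ennreal (F t) = ennreal (?e t) * ennreal (W_mix \<sigma> t)"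
        unfolding ennreal_mult'[OF e_nonneg, symmetric] using True by (simp add: F_def mult_ac)
      also have "\<dots> = (\<integral>\<^sup>+q. ennreal (?e t) * ennreal (t powr q) \<partial>\<sigma>)"
        using True ennreal_W_mix[OF assms(6,7)] by (simp only: nn_integral_cmult[OF powr_meas]) simp
      also have "\<dots> = (\<integral>\<^sup>+q. ennreal (exp (- \<gamma> * t) * t powr q * bessel_series \<mu> (t\<^sup>2 / 4)) *
          indicator {0<..<x} t \<partial>\<sigma>)"
        unfolding ennreal_mult'[OF e_nonneg, symmetric] using True
        by (intro nn_integral_cong) (simp add: mult_ac)
      finally show ?thesis .
    qed (simp add: F_def)
  qed
  also have "\<dots> = (\<integral>\<^sup>+q. (\<integral>\<^sup>+t\<in>{0<..<x}.
      ennreal (exp (- \<gamma> * t) * t powr q * bessel_series \<mu> (t\<^sup>2 / 4)) \<partial>lborel) \<partial>\<sigma>)"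
  proof -
    note [measurable] = id
    show ?thesis by (rule Fubini'[symmetric]) measurable
  qed
  also have "\<dots> \<le> (\<integral>\<^sup>+q. ennreal (M * R) * ennreal (x powr q) \<partial>\<sigma>)"
  proof (rule nn_integral_mono)
    fix q assume "q \<in> space \<sigma>"
    hence q: "q \<in> {qm..qp}" by (simp add: sp)
    have "(\<integral>\<^sup>+t\<in>{0<..<x}. ennreal (exp (- \<gamma> * t) * t powr q * bessel_series \<mu> (t\<^sup>2 / 4)) \<partial>lborel)
      \<le> ennreal (M_const \<mu> q \<gamma> \<theta> *
         (exp (- \<gamma> * x) * x powr q * (x / 2 * bessel_series (\<mu> + 1) (x\<^sup>2 / 4))))"
      using assms q x by (intro power_weight_bound) auto
    also have "exp (- \<gamma> * x) * x powr q * (x / 2 * bessel_series (\<mu> + 1) (x\<^sup>2 / 4)) = R * x powr q"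
      by (simp add: R_def)
    also have "ennreal (M_const \<mu> q \<gamma> \<theta> * (R * x powr q)) \<le> ennreal (M * (R * x powr q))"
      using M_upper[OF q] R_nonneg by (intro ennreal_leI mult_right_mono) auto
    also have "\<dots> = ennreal (M * R) * ennreal (x powr q)"
      using M_nonneg R_nonneg by (simp add: ennreal_mult'[symmetric] mult_ac)
    finally show "(\<integral>\<^sup>+t\<in>{0<..<x}. ennreal (exp (- \<gamma> * t) * t powr q *
        bessel_series \<mu> (t\<^sup>2 / 4)) \<partial>lborel) \<le> ennreal (M * R) * ennreal (x powr q)" .
  qed
  also have "\<dots> = ennreal (M * R) * ennreal (W_mix \<sigma> x)"
    using x ennreal_W_mix[OF assms(6,7)] by (simp only: nn_integral_cmult[OF powr_meas])
  also have "\<dots> = ennreal (M * R * W_mix \<sigma> x)"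
    using M_nonneg R_nonneg by (simp add: ennreal_mult')
  finally have bound: "(\<integral>\<^sup>+t. ennreal (F t) \<partial>lborel) \<le> ennreal (M * R * W_mix \<sigma> x)" .
  have F_int: "integrable lborel F"
    using F_meas F_nonneg bound
    by (intro integrableI_nonneg) (auto intro: le_less_trans)
  have F_le: "integral\<^sup>L lborel F \<le> M * R * W_mix \<sigma> x"
    using bound F_nonneg M_nonneg R_nonneg W_mix_nonneg[of \<sigma> x]
    by (subst (asm) nn_integral_eq_integral[OF F_int]) (auto simp: ennreal_le_iff)
  have g_eq: "indicator {0<..<x} t *\<^sub>R ?g t = 2 powr (- \<mu>) * F t" for t
  proof (cases "t \<in> {0<..<x}")
    case True
    hence "t powr (- \<mu>) * bessel_I \<mu> t = 2 powr (- \<mu>) * bessel_series \<mu> (t\<^sup>2 / 4)"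
      using assms(1) by (simp add: bessel_I_eq_bessel_series powr_divide powr_minus field_simps)
    thus ?thesis using True by (simp add: F_def mult.assoc)
  qed (simp add: F_def)
  show "set_integrable lborel {0<..<x} ?g"
    unfolding set_integrable_def g_eq using F_int by simp
  have "(LINT t:{0<..<x}|lborel. ?g t) = 2 powr (- \<mu>) * integral\<^sup>L lborel F"
    unfolding set_lebesgue_integral_def g_eq by simp
  also have "\<dots> \<le> 2 powr (- \<mu>) * (M * R * W_mix \<sigma> x)"
    using F_le by (intro mult_left_mono) auto
  also have "\<dots> = M * (exp (- \<gamma> * x) * W_mix \<sigma> x * x powr (- \<mu>) * bessel_I (\<mu> + 1) x)"
    using x assms(1)
    by (simp add: R_def bessel_I_eq_bessel_series powr_divide powr_minus powr_add field_simps)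
  finally show "(LINT t:{0<..<x}|lborel. ?g t) \<le> M_sup \<mu> {qm..qp} \<gamma> \<theta> *
      (exp (- \<gamma> * x) * W_mix \<sigma> x * x powr (- \<mu>) * bessel_I (\<mu> + 1) x)"
    unfolding M_def .
qed

end
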